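(* Let $n,p$ be positive integers with $p \ge n$, let $X\in\mathbb{R}^{n\times p}$ have columns normalized so that $\|X_j\|_2=\sqrt n$ for all $1\le j\le p$, and let $y = X\beta_\star+z$ with $z\sim\mathcal{N}(0,\sigma^2 I_n)$, where $\beta_\star$ has support $J_\star$ of size $s_\star$ with $1\le s_\star\le\overline{s}$. Let $\varepsilon>0$ and $c\ge1$, and suppose that Condition $\mathbf{I}((2+\varepsilon)s_\star)$ holds, that the sparsity parameter of the prior is $$\lambda=\frac{1+\varepsilon}{\varepsilon}(23+5c)\log p,$$ and that $$\min_{j\in J_\star}|\beta_{\star,j}|\ge\rho:=\frac{3\sigma\sqrt{\lambda/n}}{\nu_{(2+\varepsilon)s_\star}}.$$ Then, with probability at least $1-2p^{-c}$, $\Pi(J_\star)>\Pi(J)$ for all $J\subset[p]$ with $J\ne J_\star$, and in fact $$\Pi(J_\star)\ge1-4p^{-c}.$$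
   Context: Model: $y=X\beta_\star+z\in\mathbb{R}^n$ with $X\in\mathbb{R}^{n\times p}$ deterministic, $z\sim\mathcal{N}(0,\sigma^2 I_n)$ and $\sigma>0$ known. The vector $\beta_\star\in\mathbb{R}^p$ is one of the vectors $\beta$ of minimal support size among those satisfying $X\beta=\mathbb{E}(y)$; $J_\star\subset[p]:=\{1,\dots,p\}$ is its support and $s_\star=|J_\star|$. $\|\cdot\|_2$ is the Euclidean norm. For $J\subset[p]$, $X_J$ is the submatrix of $X$ with columns $X_j$, $j\in J$; $P_J$ is the orthogonal projection of $\mathbb{R}^n$ onto the span of $\{X_j: j\in J\}$, and $P_J^\perp=I_n-P_J$. Prior and pseudo-posterior: fix an integer upper bound $\overline{s}\le p$ on the support size (with $s_\star\le\overline{s}$) and a parameter $\lambda>0$. The prior on subsets $J\subset[p]$ is the probability distribution $\pi(J)\propto\binom{p}{|J|}^{-1}e^{-\lambda|J|}\mathbf{1}_{\{|J|\le\overline{s}\}}$, and the pseudo-posterior is the probability distribution $\Pi(J)\propto\pi(J)\exp\left(-\frac{\|P_J^\perp y\|_2^2}{2\sigma^2}\right)$. Condition $\mathbf{I}(s)$ (for real $s\ge1$): for every $J\subset[p]$ with $|J|\le s$, $X_J$ has full column rank. Also, for real $s\ge1$, $$\nu_s=\min_{J\subset[p],\,1\le|J|\le s}\ \min_{u\in\mathbb{R}^{|J|},\,\|u\|_2=1}\frac1{\sqrt n}\|X_Ju\|_2,$$ so that $\mathbf{I}(s)$ is equivalent to $\nu_s>0$. *)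

theory Defs
  imports "HOL-Probability.Probability"
begin

definition supp :: "real ^ 'p \<Rightarrow> 'p set" where
  "supp \<beta> = {j. \<beta> $ j \<noteq> 0}"

definition sparsest_representation :: "real ^ 'p ^ 'n \<Rightarrow> real ^ 'n \<Rightarrow> real ^ 'p \<Rightarrow> bool" where
  "sparsest_representation X \<mu> \<beta> \<longleftrightarrow>
     X *v \<beta> = \<mu> \<and> (\<forall>\<beta>'. X *v \<beta>' = \<mu> \<longrightarrow> card (supp \<beta>) \<le> card (supp \<beta>'))"

(* Centred Gaussian vector with covariance \<sigma>^2 I, given by its Lebesgue density.
   The argument \<sigma> is the standard deviation, as in normal_density. *)
definition isotropic_gaussian :: "'a measure \<Rightarrow> real \<Rightarrow> ('a \<Rightarrow> real ^ 'n) \<Rightarrow> bool" where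
  "isotropic_gaussian M \<sigma> z \<longleftrightarrow>
     distributed M lborel z (\<lambda>v. ennreal (\<Prod>i\<in>UNIV. normal_density 0 \<sigma> (v $ i)))"

definition ortho_proj :: "'v::euclidean_space set \<Rightarrow> 'v \<Rightarrow> 'v" where
  "ortho_proj S v = (THE w. w \<in> S \<and> v - w \<in> orthogonal_comp S)"

lemma ex1_ortho_proj:
  fixes S :: "'v::euclidean_space set"
  assumes "subspace S"
  shows "\<exists>!w. w \<in> S \<and> v - w \<in> orthogonal_comp S"
proof (rule ex_ex1I)
  obtain a b where "a \<in> span S" "\<And>w. w \<in> span S \<Longrightarrow> orthogonal b w" "v = a + b"
    using orthogonal_subspace_decomp_exists by blast
  then have "a \<in> S \<and> v - a \<in> orthogonal_comp S"
    using assms by (auto simp: orthogonal_comp_def orthogonal_commute span_eq_iff[THEN iffD2])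
  then show "\<exists>w. w \<in> S \<and> v - w \<in> orthogonal_comp S" by blast
next
  fix w w'
  assume w: "w \<in> S \<and> v - w \<in> orthogonal_comp S" and w': "w' \<in> S \<and> v - w' \<in> orthogonal_comp S"
  have d: "w - w' \<in> S" using assms w w' by (simp add: subspace_diff)
  have "(w - w') \<bullet> (v - w') - (w - w') \<bullet> (v - w) = 0"
    using d w w' by (simp add: orthogonal_comp_def orthogonal_def)
  then have "(w - w') \<bullet> (w - w') = 0" by (simp add: algebra_simps)
  then show "w = w'" by simp
qed

lemma ortho_proj:
  fixes S :: "'v::euclidean_space set"
  assumes "subspace S"
  shows "ortho_proj S v \<in> S" "v - ortho_proj S v \<in> orthogonal_comp S"
  using theI'[OF ex1_ortho_proj[OF assms, of v]] by (simp_all add: ortho_proj_def)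

definition col_proj :: "real ^ 'p ^ 'n \<Rightarrow> 'p set \<Rightarrow> real ^ 'n \<Rightarrow> real ^ 'n" where
  "col_proj X J = ortho_proj (span ((\<lambda>j. column j X) ` J))"

definition col_proj_perp :: "real ^ 'p ^ 'n \<Rightarrow> 'p set \<Rightarrow> real ^ 'n \<Rightarrow> real ^ 'n" where
  "col_proj_perp X J v = v - col_proj X J v"

(* The column rank of the submatrix X_J is the dimension of the span of its columns. *)
definition full_column_rank_on :: "real ^ 'p ^ 'n \<Rightarrow> 'p set \<Rightarrow> bool" where
  "full_column_rank_on X J \<longleftrightarrow> dim ((\<lambda>j. column j X) ` J) = card J"

definition condition_I :: "real ^ 'p ^ 'n \<Rightarrow> real \<Rightarrow> bool" where
  "condition_I X s \<longleftrightarrow> (\<forall>J. real (card J) \<le> s \<longrightarrow> full_column_rank_on X J)"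

(* R^J is identified with the vectors u supported in J, for which X *v u is X_J applied to
   the restriction of u. For nonempty J the infimum is over a compact sphere,
   hence attained; the outer minimum is over a nonempty finite set when s is at least 1. *)
definition nu :: "real ^ 'p ^ 'n \<Rightarrow> real \<Rightarrow> real" where
  "nu X s = (MIN J\<in>{J. 1 \<le> card J \<and> real (card J) \<le> s}.
               INF u\<in>{u. supp u \<subseteq> J \<and> norm u = 1}. norm (X *v u) / sqrt (real CARD('n)))"

definition prior_weight :: "nat \<Rightarrow> real \<Rightarrow> 'p::finite set \<Rightarrow> real" where
  "prior_weight sbar lam J =
     (if card J \<le> sbar then exp (- lam * real (card J)) / real (CARD('p) choose card J) else 0)"

definition prior :: "nat \<Rightarrow> real \<Rightarrow> 'p::finite set \<Rightarrow> real" where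
  "prior sbar lam J = prior_weight sbar lam J / (\<Sum>K::'p set\<in>UNIV. prior_weight sbar lam K)"

definition posterior_weight ::
  "real ^ 'p ^ 'n \<Rightarrow> real \<Rightarrow> nat \<Rightarrow> real \<Rightarrow> real ^ 'n \<Rightarrow> 'p set \<Rightarrow> real" where
  "posterior_weight X \<sigma> sbar lam y J =
     prior sbar lam J * exp (- (norm (col_proj_perp X J y))\<^sup>2 / (2 * \<sigma>\<^sup>2))"

definition posterior ::
  "real ^ 'p ^ 'n \<Rightarrow> real \<Rightarrow> nat \<Rightarrow> real \<Rightarrow> real ^ 'n \<Rightarrow> 'p set \<Rightarrow> real" where
  "posterior X \<sigma> sbar lam y J =
     posterior_weight X \<sigma> sbar lam y J / (\<Sum>K\<in>UNIV. posterior_weight X \<sigma> sbar lam y K)"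

end

theory Submission
  imports Defs
begin

text \<open>Let V be the span of the columns in the union of the true support and a model J, and put
  L = ln p. The noise enters the ratio of the posterior weights of J and of the true support only
  through the squared norm of its projection onto the part of V orthogonal to the true column span,
  which has dimension at most t, the number of superfluous indices of J, and through its inner
  product with the part of the mean that J does not explain. Chernoff bounds and union bounds over
  the superfluous sets, respectively over the symmetric differences with the true support, control
  both terms for all J at once, up to probability 2 p^(-c). On this event, a model differing from
  the true support in k indices has relative weight at most p^(-(c+8)k): a model of size at most
  (1+\<epsilon>)s pays for each missing index through the signal strength and the restricted eigenvalue and
  for each superfluous one through the prior, and a larger model is excluded by the prior alone. The
  weights are then summed with the binomial theorem.\<close>

section \<open>Orthonormal families and nested projections\<close>

lemma ortho_projI:
  assumes "subspace S" "w \<in> S" "v - w \<in> orthogonal_comp S"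
  shows "ortho_proj S v = w"
  unfolding ortho_proj_def by (rule the1_equality[OF ex1_ortho_proj]) (use assms in auto)

definition orthonormal :: "'v::euclidean_space set \<Rightarrow> bool" where
  "orthonormal B \<longleftrightarrow> (\<forall>a\<in>B. \<forall>b\<in>B. a \<bullet> b = (if a = b then 1 else 0))"

lemma orthonormal_independent:
  assumes "orthonormal B"
  shows "independent B"
proof (rule pairwise_orthogonal_independent)
  show "pairwise orthogonal B"
    using assms by (auto simp: orthonormal_def pairwise_def orthogonal_def)
  show "0 \<notin> B"
    using assms unfolding orthonormal_def by (metis inner_zero_left zero_neq_one)
qed

lemma orthonormal_finite: "orthonormal B \<Longrightarrow> finite B"
  using orthonormal_independent independent_imp_finite by blast

lemma orthonormal_subset: "orthonormal B \<Longrightarrow> A \<subseteq> B \<Longrightarrow> orthonormal A"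
  by (metis orthonormal_def subset_iff)

lemma obtain_orthonormal_basis:
  fixes S :: "'v::euclidean_space set"
  assumes "subspace S"
  obtains B where "orthonormal B" "span B = S"
proof -
  obtain B where "pairwise orthogonal B" "\<And>x. x \<in> B \<Longrightarrow> norm x = 1" "span B = S"
    using orthonormal_basis_subspace[OF assms] by metis
  then show thesis
    by (intro that[of B]) (auto simp: orthonormal_def pairwise_def orthogonal_def norm_eq_1)
qed

lemma inner_orthonormal_sum:
  assumes "orthonormal B" "a \<in> B"
  shows "a \<bullet> (\<Sum>b\<in>B. f b *\<^sub>R b) = f a"
proof -
  have "a \<bullet> (\<Sum>b\<in>B. f b *\<^sub>R b) = (\<Sum>b\<in>B. if a = b then f b else 0)"
    unfolding inner_sum_right by (rule sum.cong) (use assms in \<open>auto simp: orthonormal_def\<close>)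
  then show ?thesis using assms orthonormal_finite[OF assms(1)] by simp
qed

lemma orthogonal_comp_span:
  "v \<in> orthogonal_comp (span B) \<longleftrightarrow> (\<forall>b\<in>B. b \<bullet> v = 0)"
proof
  assume "v \<in> orthogonal_comp (span B)"
  then show "\<forall>b\<in>B. b \<bullet> v = 0"
    by (auto simp: orthogonal_comp_def orthogonal_def span_base)
next
  assume "\<forall>b\<in>B. b \<bullet> v = 0"
  then have "orthogonal v w" if "w \<in> span B" for w
    by (intro orthogonal_to_span[OF that]) (auto simp: orthogonal_def inner_commute)
  then show "v \<in> orthogonal_comp (span B)"
    by (auto simp: orthogonal_comp_def orthogonal_commute)
qed

lemma ortho_proj_orthonormal:
  assumes "orthonormal B"
  shows "ortho_proj (span B) v = (\<Sum>b\<in>B. (b \<bullet> v) *\<^sub>R b)"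
proof (rule ortho_projI)
  show "(\<Sum>b\<in>B. (b \<bullet> v) *\<^sub>R b) \<in> span B"
    by (intro span_sum span_scale span_base)
  show "v - (\<Sum>b\<in>B. (b \<bullet> v) *\<^sub>R b) \<in> orthogonal_comp (span B)"
    using assms by (auto simp: orthogonal_comp_span inner_diff_right inner_orthonormal_sum)
qed simp

text \<open>Pythagoras: the projection contributes the sum of its squared coordinates, and so does
  its inner product with \<open>v\<close>.\<close>

lemma norm_residual_orthonormal:
  assumes "orthonormal B"
  shows "(norm (v - ortho_proj (span B) v))\<^sup>2 + (\<Sum>b\<in>B. (b \<bullet> v)\<^sup>2) = (norm v)\<^sup>2"
proof -
  let ?w = "\<Sum>b\<in>B. (b \<bullet> v) *\<^sub>R b"
  have "?w \<bullet> ?w = (\<Sum>b\<in>B. (b \<bullet> v)\<^sup>2)"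
    by (subst inner_sum_left) (simp add: inner_orthonormal_sum[OF assms] power2_eq_square)
  moreover have "?w \<bullet> v = (\<Sum>b\<in>B. (b \<bullet> v)\<^sup>2)"
    by (simp add: inner_sum_left power2_eq_square)
  ultimately show ?thesis
    unfolding ortho_proj_orthonormal[OF assms] power2_norm_eq_inner
    by (simp add: inner_diff_left inner_diff_right inner_commute)
qed

lemma linear_ortho_proj:
  assumes "subspace S"
  shows "linear (ortho_proj S)"
proof -
  obtain B where B: "orthonormal B" "span B = S"
    using obtain_orthonormal_basis[OF assms] .
  have "ortho_proj S = (\<lambda>v. \<Sum>b\<in>B. (b \<bullet> v) *\<^sub>R b)"
    using ortho_proj_orthonormal B by blast
  then show ?thesis
    by (auto intro!: linearI simp: inner_right_distrib scaleR_left_distrib sum.distrib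
        scaleR_right.sum)
qed

lemma ortho_proj_self:
  assumes "subspace S" "v \<in> S"
  shows "ortho_proj S v = v"
  by (rule ortho_projI) (use assms in \<open>auto simp: orthogonal_comp_def orthogonal_def\<close>)

text \<open>An orthonormal basis of \<open>U\<close> together with one of the part of
  \<open>V\<close> orthogonal to \<open>U\<close> is an orthonormal basis of \<open>V\<close>; the
  two Pythagorean identities are subtracted. The drop in squared residual thus becomes a sum of
  \<open>card B\<close> squared coordinates, which is what the chi-square bound needs.\<close>

lemma residual_nested:
  fixes U V :: "'v::euclidean_space set"
  assumes "subspace U" "subspace V" "U \<subseteq> V"
  obtains B where "orthonormal B" "card B + dim U = dim V"
    "\<And>v. (norm (v - ortho_proj V v))\<^sup>2 + (\<Sum>b\<in>B. (b \<bullet> v)\<^sup>2) = (norm (v - ortho_proj U v))\<^sup>2"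
proof -
  obtain S where S: "orthonormal S" "span S = U"
    using obtain_orthonormal_basis[OF assms(1)] .
  have "subspace (V \<inter> orthogonal_comp U)"
    by (intro subspace_inter assms subspace_orthogonal_comp)
  then obtain B where B: "orthonormal B" "span B = V \<inter> orthogonal_comp U"
    using obtain_orthonormal_basis by blast
  have SB: "a \<bullet> b = 0" if "a \<in> S" "b \<in> B" for a b
  proof -
    have "b \<in> orthogonal_comp U" "a \<in> U"
      using span_base[OF that(1)] span_base[OF that(2)] S B by auto
    then show ?thesis by (simp add: orthogonal_comp_def orthogonal_def inner_commute)
  qed
  have disj: "S \<inter> B = {}"
  proof -
    have "a \<bullet> a = 1" if "a \<in> S" for a using S(1) that by (simp add: orthonormal_def)
    then show ?thesis using SB by fastforce
  qed
  have on: "orthonormal (S \<union> B)"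
    using S(1) B(1) SB disj unfolding orthonormal_def by (metis IntI Un_iff empty_iff inner_commute)
  have span: "span (S \<union> B) = V"
  proof
    show "span (S \<union> B) \<subseteq> V"
    proof (rule span_minimal)
      show "S \<union> B \<subseteq> V"
        using S B assms(3) span_superset[of S] span_superset[of B] by auto
    qed fact
    show "V \<subseteq> span (S \<union> B)"
    proof
      fix v assume "v \<in> V"
      let ?w = "ortho_proj U v"
      have "?w \<in> U" "v - ?w \<in> orthogonal_comp U" using ortho_proj[OF assms(1)] by auto
      moreover then have "v - ?w \<in> V" using \<open>v \<in> V\<close> assms by (auto intro: subspace_diff)
      ultimately have "?w \<in> span S" "v - ?w \<in> span B" using S B by auto
      then have "?w + (v - ?w) \<in> span (S \<union> B)"
        by (meson span_add span_mono subsetD sup_ge1 sup_ge2)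
      then show "v \<in> span (S \<union> B)" by simp
    qed
  qed
  have fin: "finite S" "finite B" using S B orthonormal_finite by auto
  have "card S = dim U" "card (S \<union> B) = dim V"
    using dim_eq_card[OF refl orthonormal_independent[OF S(1)]]
      dim_eq_card[OF refl orthonormal_independent[OF on]] by (simp_all add: S(2)[symmetric] span[symmetric])
  then have "card B + dim U = dim V" using card_Un_disjoint[OF fin disj] by simp
  moreover have "(norm (v - ortho_proj V v))\<^sup>2 + (\<Sum>b\<in>B. (b \<bullet> v)\<^sup>2) = (norm (v - ortho_proj U v))\<^sup>2" for v
    using norm_residual_orthonormal[OF on, of v] norm_residual_orthonormal[OF S(1), of v]
    unfolding span S(2) sum.union_disjoint[OF fin disj] by simp
  ultimately show thesis using that B(1) by blast
qed

lemma dim_Un_image_le: "finite T \<Longrightarrow> dim (A \<union> f ` T) \<le> dim A + card T"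
  for A :: "'v::euclidean_space set"
proof (induction T rule: finite_induct)
  case (insert x T)
  have "dim (A \<union> f ` insert x T) \<le> Suc (dim (A \<union> f ` T))"
    by (simp add: dim_insert)
  then show ?case using insert by simp
qed simp

section \<open>Exponential moments of Gaussian vectors\<close>

text \<open>Completing the square: the tilted density is a constant times the normal density with
  mean \<open>r\<close>.\<close>

lemma nn_integral_std_normal_exp_linear:
  fixes r :: real
  shows "(\<integral>\<^sup>+x. ennreal (std_normal_density x * exp (r * x)) \<partial>lborel) = ennreal (exp (r\<^sup>2 / 2))"
proof -
  have "std_normal_density x * exp (r * x) = exp (r\<^sup>2 / 2) * normal_density r 1 x" for x
    by (simp add: normal_density_def mult_exp_exp power2_diff field_simps)
  then have "(\<integral>\<^sup>+x. ennreal (std_normal_density x * exp (r * x)) \<partial>lborel) =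
      ennreal (\<integral>x. exp (r\<^sup>2 / 2) * normal_density r 1 x \<partial>lborel)"
    by (subst nn_integral_eq_integral[symmetric]) auto
  then show ?thesis by simp
qed

text \<open>The tilted density is that of variance 2, up to the factor \<open>sqrt 2\<close>. This
  is the chi-square generating function at 1/4 with one degree of freedom.\<close>

lemma nn_integral_std_normal_exp_square:
  "(\<integral>\<^sup>+x. ennreal (std_normal_density x * exp (x\<^sup>2 / 4)) \<partial>lborel) = ennreal (sqrt 2)"
proof -
  have "std_normal_density x * exp (x\<^sup>2 / 4) = sqrt 2 * normal_density 0 (sqrt 2) x" for x
    by (simp add: normal_density_def mult_exp_exp real_sqrt_mult field_simps)
  then have "(\<integral>\<^sup>+x. ennreal (std_normal_density x * exp (x\<^sup>2 / 4)) \<partial>lborel) =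
      ennreal (\<integral>x. sqrt 2 * normal_density 0 (sqrt 2) x \<partial>lborel)"
    by (subst nn_integral_eq_integral[symmetric]) auto
  then show ?thesis by simp
qed

section \<open>Gaussian noise vectors\<close>

lemma isotropic_gaussian_measurable:
  "isotropic_gaussian M \<sigma> z \<Longrightarrow> z \<in> borel_measurable M"
  unfolding isotropic_gaussian_def by (auto dest: distributed_measurable)

text \<open>Completing the square in each coordinate, the exponential tilt translates the density by
  \<sigma>^2 v and leaves a constant factor; Lebesgue measure is translation invariant.\<close>

lemma nn_integral_gaussian_exp_linear:
  fixes z :: "'a \<Rightarrow> real ^ 'n" and v :: "real ^ 'n"
  assumes "prob_space M" "\<sigma> > 0" and iso: "isotropic_gaussian M \<sigma> z"
  shows "(\<integral>\<^sup>+\<omega>. ennreal (exp (v \<bullet> z \<omega>)) \<partial>M) = ennreal (exp (\<sigma>\<^sup>2 * (norm v)\<^sup>2 / 2))"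
proof -
  interpret prob_space M by fact
  let ?f = "\<lambda>u :: real ^ 'n. \<Prod>i\<in>UNIV. normal_density 0 \<sigma> (u $ i)"
  let ?C = "exp (\<sigma>\<^sup>2 * (norm v)\<^sup>2 / 2)"
  have dist: "distributed M lborel z (\<lambda>u. ennreal (?f u))"
    using iso by (simp add: isotropic_gaussian_def)
  have [measurable]: "?f \<in> borel_measurable borel"
    by measurable
  have one: "normal_density 0 \<sigma> x * exp (w * x) = exp (\<sigma>\<^sup>2 * w\<^sup>2 / 2) * normal_density 0 \<sigma> (x - \<sigma>\<^sup>2 * w)"
    for x w
    using \<open>\<sigma> > 0\<close> by (simp add: normal_density_def mult_exp_exp)
      (simp add: field_simps power2_eq_square)
  have shift: "?f u * exp (v \<bullet> u) = ?C * ?f (- (\<sigma>\<^sup>2 *\<^sub>R v) + u)" for u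
  proof -
    have "?f u * exp (v \<bullet> u) = (\<Prod>i\<in>UNIV. normal_density 0 \<sigma> (u $ i) * exp (v $ i * u $ i))"
      by (simp add: prod.distrib inner_vec_def exp_sum)
    also have "\<dots> = (\<Prod>i\<in>UNIV. exp (\<sigma>\<^sup>2 * (v $ i)\<^sup>2 / 2) * normal_density 0 \<sigma> (u $ i - \<sigma>\<^sup>2 * v $ i))"
      by (simp only: one)
    also have "\<dots> = exp (\<Sum>i\<in>UNIV. \<sigma>\<^sup>2 * (v $ i)\<^sup>2 / 2) * ?f (- (\<sigma>\<^sup>2 *\<^sub>R v) + u)"
      by (simp add: prod.distrib exp_sum)
    also have "(\<Sum>i\<in>UNIV. \<sigma>\<^sup>2 * (v $ i)\<^sup>2 / 2) = \<sigma>\<^sup>2 * (norm v)\<^sup>2 / 2"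
      unfolding power2_norm_eq_inner
      by (simp add: inner_vec_def power2_eq_square sum_distrib_left sum_divide_distrib)
    finally show ?thesis .
  qed
  \<comment> \<open>The total mass is one because \<open>?f\<close> is the density of
    \<open>z\<close> under a probability measure.\<close>
  have "(\<integral>\<^sup>+u. ennreal (?f u) \<partial>lborel) = (\<integral>\<^sup>+u. ennreal (?f u) * 1 \<partial>lborel)"
    by simp
  also have "\<dots> = (\<integral>\<^sup>+\<omega>. 1 \<partial>M)"
    by (rule distributed_nn_integral[OF dist]) simp
  finally have total: "(\<integral>\<^sup>+u. ennreal (?f u) \<partial>lborel) = 1"
    by (simp add: emeasure_space_1)
  have "(\<integral>\<^sup>+\<omega>. ennreal (exp (v \<bullet> z \<omega>)) \<partial>M) = (\<integral>\<^sup>+u. ennreal (?f u) * ennreal (exp (v \<bullet> u)) \<partial>lborel)"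
    by (rule distributed_nn_integral[OF dist, symmetric]) simp
  also have "\<dots> = (\<integral>\<^sup>+u. ennreal ?C * ennreal (?f (- (\<sigma>\<^sup>2 *\<^sub>R v) + u)) \<partial>lborel)"
    by (simp add: shift prod_nonneg flip: ennreal_mult)
  also have "\<dots> = ennreal ?C * (\<integral>\<^sup>+u. ennreal (?f (- (\<sigma>\<^sup>2 *\<^sub>R v) + u)) \<partial>lborel)"
    by (rule nn_integral_cmult) measurable
  also have "(\<integral>\<^sup>+u. ennreal (?f (- (\<sigma>\<^sup>2 *\<^sub>R v) + u)) \<partial>lborel) =
      (\<integral>\<^sup>+u. ennreal (?f u) \<partial>distr lborel borel ((+) (- (\<sigma>\<^sup>2 *\<^sub>R v))))"
    by (subst nn_integral_distr) auto
  also have "\<dots> = 1" using total by (simp only: lborel_distr_plus)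
  finally show ?thesis by simp
qed

text \<open>Writing exp of a square as a Gaussian mixture of exponentials of linear forms reduces the
  chi-square generating function to the linear one, with no rotation of coordinates.\<close>

lemma nn_integral_gaussian_exp_chi_square:
  fixes z :: "'a \<Rightarrow> real ^ 'n" and v :: "real ^ 'n"
  assumes M: "prob_space M" and "\<sigma> > 0" and iso: "isotropic_gaussian M \<sigma> z"
    and "orthonormal B" and "\<forall>b\<in>B. b \<bullet> v = 0"
  shows "(\<integral>\<^sup>+\<omega>. ennreal (exp (v \<bullet> z \<omega> + (\<Sum>b\<in>B. (b \<bullet> z \<omega>)\<^sup>2) / (4 * \<sigma>\<^sup>2))) \<partial>M) =
    ennreal (exp (\<sigma>\<^sup>2 * (norm v)\<^sup>2 / 2) * sqrt 2 ^ card B)"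
proof -
  have "finite B" using assms(4) by (rule orthonormal_finite)
  then show ?thesis using assms(4,5)
  proof (induction B arbitrary: v rule: finite_induct)
    case empty
    then show ?case using nn_integral_gaussian_exp_linear[OF assms(1-3)] by simp
  next
    case (insert b B)
    interpret prob_space M by fact
    interpret pair_sigma_finite M "lborel :: real measure" ..
    have [measurable]: "z \<in> borel_measurable M" using iso by (rule isotropic_gaussian_measurable)
    have b: "b \<bullet> b = 1" "b \<bullet> v = 0" "\<forall>a\<in>B. a \<bullet> b = 0"
      using insert.prems insert.hyps by (auto simp: orthonormal_def)
    \<comment> \<open>The scale is chosen so that averaging
      \<open>exp (?h x \<bullet> z \<omega>)\<close> over a standard normal \<open>x\<close> gives
      exp((b . z)^2 / (4 \<sigma>^2)). The linear term \<open>v\<close> is kept arbitrary in the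
      induction so that it can absorb \<open>?h x\<close>.\<close>
    let ?h = "\<lambda>x. (x / (sqrt 2 * \<sigma>)) *\<^sub>R b"
    let ?g = "\<lambda>x \<omega>. exp ((v + ?h x) \<bullet> z \<omega> + (\<Sum>b\<in>B. (b \<bullet> z \<omega>)\<^sup>2) / (4 * \<sigma>\<^sup>2))"
    have mix: "ennreal (exp (v \<bullet> z \<omega> + (\<Sum>b\<in>insert b B. (b \<bullet> z \<omega>)\<^sup>2) / (4 * \<sigma>\<^sup>2))) =
        (\<integral>\<^sup>+x. ennreal (std_normal_density x) * ennreal (?g x \<omega>) \<partial>lborel)" for \<omega>
    proof -
      let ?E = "exp (v \<bullet> z \<omega> + (\<Sum>b\<in>B. (b \<bullet> z \<omega>)\<^sup>2) / (4 * \<sigma>\<^sup>2))"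
      let ?r = "b \<bullet> z \<omega> / (sqrt 2 * \<sigma>)"
      have "ennreal (exp (v \<bullet> z \<omega> + (\<Sum>b\<in>insert b B. (b \<bullet> z \<omega>)\<^sup>2) / (4 * \<sigma>\<^sup>2))) =
          ennreal ?E * ennreal (exp (?r\<^sup>2 / 2))"
        using insert.hyps
        by (simp add: mult_exp_exp add_divide_distrib power_mult_distrib power_divide add_ac flip: ennreal_mult)
      also have "\<dots> = (\<integral>\<^sup>+x. ennreal ?E * ennreal (std_normal_density x * exp (?r * x)) \<partial>lborel)"
        unfolding nn_integral_std_normal_exp_linear[of ?r, symmetric]
        by (rule nn_integral_cmult[symmetric]) measurable
      also have "\<dots> = (\<integral>\<^sup>+x. ennreal (std_normal_density x) * ennreal (?g x \<omega>) \<partial>lborel)"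
        by (intro nn_integral_cong)
          (simp add: exp_add inner_add_left mult_ac flip: ennreal_mult)
      finally show ?thesis .
    qed
    have "(\<integral>\<^sup>+\<omega>. ennreal (exp (v \<bullet> z \<omega> + (\<Sum>b\<in>insert b B. (b \<bullet> z \<omega>)\<^sup>2) / (4 * \<sigma>\<^sup>2))) \<partial>M) =
        (\<integral>\<^sup>+x. \<integral>\<^sup>+\<omega>. ennreal (std_normal_density x) * ennreal (?g x \<omega>) \<partial>M \<partial>lborel)"
      unfolding mix by (rule Fubini'[symmetric]) measurable
    also have "\<dots> = (\<integral>\<^sup>+x. ennreal (std_normal_density x) *
        ennreal (exp (\<sigma>\<^sup>2 * (norm (v + ?h x))\<^sup>2 / 2) * sqrt 2 ^ card B) \<partial>lborel)"
    proof (intro nn_integral_cong)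
      fix x
      have "orthonormal B" using insert.prems(1) by (rule orthonormal_subset) auto
      moreover have "\<forall>a\<in>B. a \<bullet> (v + ?h x) = 0" using b insert.prems by (simp add: inner_add_right)
      ultimately have "(\<integral>\<^sup>+\<omega>. ennreal (?g x \<omega>) \<partial>M) =
          ennreal (exp (\<sigma>\<^sup>2 * (norm (v + ?h x))\<^sup>2 / 2) * sqrt 2 ^ card B)"
        by (rule insert.IH)
      then show "(\<integral>\<^sup>+\<omega>. ennreal (std_normal_density x) * ennreal (?g x \<omega>) \<partial>M) =
          ennreal (std_normal_density x) *
          ennreal (exp (\<sigma>\<^sup>2 * (norm (v + ?h x))\<^sup>2 / 2) * sqrt 2 ^ card B)"
        by (simp add: nn_integral_cmult)
    qed
    also have "\<dots> = (\<integral>\<^sup>+x. ennreal (exp (\<sigma>\<^sup>2 * (norm v)\<^sup>2 / 2) * sqrt 2 ^ card B) *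
        ennreal (std_normal_density x * exp (x\<^sup>2 / 4)) \<partial>lborel)"
    proof (intro nn_integral_cong)
      fix x
      \<comment> \<open>Since \<open>b\<close> is a unit vector orthogonal to \<open>v\<close>, the
        mixture adds exactly x^2/4 to the exponent, and integrating over \<open>x\<close> gives the
        new factor \<open>sqrt 2\<close>.\<close>
      have n: "(norm (v + ?h x))\<^sup>2 = (norm v)\<^sup>2 + x\<^sup>2 / (2 * \<sigma>\<^sup>2)"
        unfolding power2_norm_eq_inner using b
        by (simp add: inner_add_left inner_add_right inner_commute power_divide power_mult_distrib
            flip: power2_eq_square)
      have eq: "\<sigma>\<^sup>2 * (norm (v + ?h x))\<^sup>2 / 2 = \<sigma>\<^sup>2 * (norm v)\<^sup>2 / 2 + x\<^sup>2 / 4"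
        unfolding n using \<open>\<sigma> > 0\<close> by (simp add: field_simps)
      show "ennreal (std_normal_density x) *
          ennreal (exp (\<sigma>\<^sup>2 * (norm (v + ?h x))\<^sup>2 / 2) * sqrt 2 ^ card B) =
        ennreal (exp (\<sigma>\<^sup>2 * (norm v)\<^sup>2 / 2) * sqrt 2 ^ card B) *
          ennreal (std_normal_density x * exp (x\<^sup>2 / 4))"
        unfolding eq exp_add by (simp add: mult_ac flip: ennreal_mult)
    qed
    also have "\<dots> = ennreal (exp (\<sigma>\<^sup>2 * (norm v)\<^sup>2 / 2) * sqrt 2 ^ card (insert b B))"
      using insert.hyps
      by (subst nn_integral_cmult)
        (simp_all add: nn_integral_std_normal_exp_square mult_ac flip: ennreal_mult)
    finally show ?case .
  qed
qed

text \<open>Chernoff's bound: Markov's inequality for \<open>exp (f \<omega>)\<close>, with any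
  scaling already inside \<open>f\<close>.\<close>

lemma (in prob_space) prob_ge_le_exp_moment:
  assumes [measurable]: "f \<in> borel_measurable M"
    and "(\<integral>\<^sup>+\<omega>. ennreal (exp (f \<omega>)) \<partial>M) = ennreal C" "C \<ge> 0"
  shows "prob {\<omega>\<in>space M. f \<omega> \<ge> a} \<le> C * exp (- a)"
proof -
  have "emeasure M {\<omega>\<in>space M. 1 \<le> ennreal (exp (- a)) * ennreal (exp (f \<omega>))} \<le>
      ennreal (exp (- a)) * (\<integral>\<^sup>+\<omega>. ennreal (exp (f \<omega>)) * indicator (space M) \<omega> \<partial>M)"
    by (rule nn_integral_Markov_inequality) auto
  also have "(\<integral>\<^sup>+\<omega>. ennreal (exp (f \<omega>)) * indicator (space M) \<omega> \<partial>M) = ennreal C"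
    unfolding assms(2)[symmetric] by (intro nn_integral_cong) auto
  also have "{\<omega>\<in>space M. 1 \<le> ennreal (exp (- a)) * ennreal (exp (f \<omega>))} = {\<omega>\<in>space M. f \<omega> \<ge> a}"
    by (auto simp: mult_exp_exp simp flip: ennreal_mult)
  finally show ?thesis
    using assms(3) by (simp add: emeasure_eq_measure mult.commute flip: ennreal_mult)
qed

section \<open>Combinatorics of supports\<close>

lemma sum_subsets_power:
  fixes x :: real
  shows "(\<Sum>K\<in>(UNIV :: 'p::finite set set). x ^ card K) = (1 + x) ^ CARD('p)"
  using prod_add[of "UNIV :: 'p set" "\<lambda>_. x" "\<lambda>_. 1"] by (simp add: add.commute)

text \<open>The full sum is (1 + x)^p \<le> exp(p x) \<le> 1 + 2 p x, and the empty set accounts for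
  the 1. This serves both union bounds and the final summation of posterior weights.\<close>

lemma sum_nonempty_subsets_power_le:
  fixes x :: real
  assumes "0 \<le> x" "real CARD('p::finite) * x \<le> 1 / 2"
  shows "(\<Sum>K\<in>- {{} :: 'p set}. x ^ card K) \<le> 2 * (real CARD('p) * x)"
proof -
  have "1 + (\<Sum>K\<in>- {{} :: 'p set}. x ^ card K) = (\<Sum>K\<in>(UNIV :: 'p set set). x ^ card K)"
    by (subst sum.remove[of UNIV "{}"]) (auto simp: Compl_eq_Diff_UNIV)
  also have "\<dots> \<le> exp x ^ CARD('p)"
    unfolding sum_subsets_power using assms by (intro power_mono) auto
  also have "\<dots> = exp (real CARD('p) * x)" by (simp add: exp_of_nat_mult)
  also have "\<dots> \<le> 1 + 2 * (real CARD('p) * x)"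
    using assms by (intro real_exp_bound_lemma) auto
  finally show ?thesis by simp
qed

text \<open>Symmetric difference with \<open>J0\<close> is an involution on sets that sends
  \<open>J0\<close> to the empty set.\<close>

lemma sum_sym_diff_reindex:
  fixes J0 :: "'p::finite set"
  shows "(\<Sum>J\<in>- {J0}. f (sym_diff J J0)) = (\<Sum>K\<in>- {{}}. f K)"
  by (rule sum.reindex_bij_witness[where i = "\<lambda>K. sym_diff K J0" and j = "\<lambda>J. sym_diff J J0"]) auto

section \<open>Ratios of binomial coefficients\<close>

lemma choose_Suc_mult: "Suc i * (p choose Suc i) = (p - i) * (p choose i)"
  by (simp only: binomial_absorption binomial_absorb_comp)

text \<open>Consecutive coefficients have ratio (p - j)/(j + 1), whose numerator and denominator
  both lie between 1 and p; so each step costs at most a factor p in either direction.\<close>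

lemma choose_le_power_mult_choose:
  assumes "i + d \<le> p"
  shows "(p choose i) \<le> p ^ d * (p choose (i + d)) \<and> (p choose (i + d)) \<le> p ^ d * (p choose i)"
  using assms
proof (induction d)
  case (Suc d)
  let ?j = "i + d"
  have eq: "Suc ?j * (p choose Suc ?j) = (p - ?j) * (p choose ?j)"
    by (rule choose_Suc_mult)
  have "1 * (p choose ?j) \<le> (p - ?j) * (p choose ?j)"
    using Suc.prems by (intro mult_right_mono) auto
  also have "\<dots> \<le> p * (p choose Suc ?j)"
    unfolding eq[symmetric] using Suc.prems by (intro mult_right_mono) auto
  finally have up: "(p choose ?j) \<le> p * (p choose Suc ?j)" by simp
  have "1 * (p choose Suc ?j) \<le> Suc ?j * (p choose Suc ?j)"
    by (intro mult_right_mono) auto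
  also have "\<dots> \<le> p * (p choose ?j)"
    unfolding eq by (intro mult_right_mono) auto
  finally have down: "(p choose Suc ?j) \<le> p * (p choose ?j)" by simp
  have IH: "(p choose i) \<le> p ^ d * (p choose ?j)" "(p choose ?j) \<le> p ^ d * (p choose i)"
    using Suc by auto
  have "(p choose i) \<le> p ^ d * (p * (p choose Suc ?j))"
    using IH(1) up by (meson le_trans mult_le_mono2)
  moreover have "(p choose Suc ?j) \<le> p * (p ^ d * (p choose i))"
    using IH(2) down by (meson le_trans mult_le_mono2)
  ultimately show ?case by (simp add: mult_ac)
qed simp

lemma choose_le_power_mult_choose_dist:
  assumes "0 < p" "i \<le> p" "j \<le> p" "i \<le> j + d" "j \<le> i + d"
  shows "(p choose i) \<le> p ^ d * (p choose j)"
proof -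
  have "\<exists>e \<le> d. (p choose i) \<le> p ^ e * (p choose j)"
  proof (cases "i \<le> j")
    case True
    with assms choose_le_power_mult_choose[of i "j - i" p] show ?thesis
      by (intro exI[of _ "j - i"]) auto
  next
    case False
    with assms choose_le_power_mult_choose[of j "i - j" p] show ?thesis
      by (intro exI[of _ "i - j"]) auto
  qed
  then obtain e where "e \<le> d" "(p choose i) \<le> p ^ e * (p choose j)" by blast
  moreover have "p ^ e * (p choose j) \<le> p ^ d * (p choose j)"
    using assms(1) \<open>e \<le> d\<close> by (intro mult_right_mono power_increasing) auto
  ultimately show ?thesis by linarith
qed

section \<open>Projections onto column spans and the sparse eigenvalue\<close>

abbreviation col_span :: "real ^ 'p ^ 'n \<Rightarrow> 'p set \<Rightarrow> (real ^ 'n) set" where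
  "col_span X J \<equiv> span ((\<lambda>j. column j X) ` J)"

text \<open>Lets vectors supported in \<open>J\<close> play the role of coefficient vectors of the
  submatrix, matching the encoding in \<open>nu\<close>.\<close>

lemma in_col_span_iff:
  fixes X :: "real ^ 'p ^ 'n"
  shows "w \<in> col_span X J \<longleftrightarrow> (\<exists>u. supp u \<subseteq> J \<and> w = X *v u)"
proof
  let ?S = "(*v) X ` {u. supp u \<subseteq> J}"
  have sub: "subspace {u :: real ^ 'p. supp u \<subseteq> J}"
    by (auto simp: subspace_def supp_def subset_iff) (metis add.right_neutral)
  have "subspace ?S"
    by (rule linear_subspace_image[OF _ sub]) simp
  moreover have "(\<lambda>j. column j X) ` J \<subseteq> ?S"
    by (force simp: supp_def axis_def simp flip: matrix_vector_mult_basis)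
  ultimately have "col_span X J \<subseteq> ?S" by (intro span_minimal)
  then show "w \<in> col_span X J \<Longrightarrow> \<exists>u. supp u \<subseteq> J \<and> w = X *v u" by blast
next
  assume "\<exists>u. supp u \<subseteq> J \<and> w = X *v u"
  then obtain u where u: "supp u \<subseteq> J" "w = X *v u" by blast
  have "u $ j *s column j X \<in> col_span X J" for j
  proof (cases "j \<in> J")
    case True
    then show ?thesis unfolding scalar_mult_eq_scaleR by (intro span_scale span_base) auto
  next
    case False
    then have "u $ j = 0" using u(1) by (auto simp: supp_def)
    then show ?thesis by (simp add: span_zero)
  qed
  then show "w \<in> col_span X J"
    unfolding u(2) matrix_mult_sum by (intro span_sum) auto
qed

text \<open>By homogeneity \<open>u\<close> can be scaled to the unit sphere; its own support is
  then an admissible set in the minimum.\<close>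

lemma nu_mult_norm_le:
  fixes X :: "real ^ 'p ^ 'n" and u :: "real ^ 'p"
  assumes "real (card (supp u)) \<le> r"
  shows "nu X r * sqrt (real CARD('n)) * norm u \<le> norm (X *v u)"
proof (cases "u = 0")
  case False
  let ?h = "\<lambda>u. norm (X *v u) / sqrt (real CARD('n))"
  have "supp u \<noteq> {}" using False by (auto simp: supp_def vec_eq_iff)
  then have "1 \<le> card (supp u)" by (simp add: Suc_le_eq card_gt_0_iff)
  then have "nu X r \<le> (INF u\<in>{v. supp v \<subseteq> supp u \<and> norm v = 1}. ?h u)"
    unfolding nu_def using assms by (intro Min_le) auto
  also have "\<dots> \<le> ?h (u /\<^sub>R norm u)"
    using False by (intro cINF_lower bdd_belowI2[where m = 0]) (auto simp: supp_def)
  also have "\<dots> = norm (X *v u) / norm u / sqrt (real CARD('n))"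
    by (simp add: matrix_vector_mult_scaleR divide_inverse mult_ac)
  finally show ?thesis using False by (simp add: field_simps)
qed simp

lemma full_column_rank_on_inj:
  fixes X :: "real ^ 'p ^ 'n" and u :: "real ^ 'p"
  assumes "full_column_rank_on X J" "supp u \<subseteq> J" "X *v u = 0"
  shows "u = 0"
proof -
  let ?C = "(\<lambda>j. column j X) ` J"
  have dim: "dim ?C = card J" using assms(1) by (simp add: full_column_rank_on_def)
  have "dim ?C \<le> card ?C" by (intro dim_le_card span_superset) auto
  \<comment> \<open>The columns form a set, so repeated ones would be merged; full dimension rules
    this out and makes the column map injective on \<open>J\<close>.\<close>
  then have card: "card ?C = card J" using dim card_image_le[of J "\<lambda>j. column j X"] by simp
  then have inj: "inj_on (\<lambda>j. column j X) J" by (intro eq_card_imp_inj_on) auto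
  have ind: "independent ?C"
    by (rule card_le_dim_spanning[of ?C ?C]) (use dim card in \<open>auto intro: span_base\<close>)
  have "(\<Sum>j\<in>J. u $ j *\<^sub>R column j X) = (\<Sum>j\<in>UNIV. u $ j *s column j X)"
    unfolding scalar_mult_eq_scaleR
    by (intro sum.mono_neutral_left) (use assms(2) in \<open>auto simp: supp_def\<close>)
  also have "\<dots> = 0" using assms(3) by (simp add: matrix_mult_sum)
  finally have "(\<Sum>v\<in>?C. u $ (inv_into J (\<lambda>j. column j X) v) *\<^sub>R v) = 0"
    by (simp add: sum.reindex[OF inj] inv_into_f_f[OF inj])
  then have "\<forall>v\<in>?C. u $ (inv_into J (\<lambda>j. column j X) v) = 0"
    using ind by (auto simp: independent_explicit)
  then have "u $ j = 0" if "j \<in> J" for j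
    using that by (auto simp: inv_into_f_f[OF inj])
  then show ?thesis using assms(2) by (auto simp: supp_def vec_eq_iff)
qed

text \<open>Each inner infimum is attained, since unit vectors supported in \<open>J\<close> form a
  compact set, and it is nonzero by injectivity. The outer minimum is over finitely many
  sets.\<close>

lemma nu_pos:
  fixes X :: "real ^ 'p ^ 'n"
  assumes I: "condition_I X r" and "1 \<le> r"
  shows "nu X r > 0"
proof -
  let ?h = "\<lambda>u. norm (X *v u) / sqrt (real CARD('n))"
  let ?S = "\<lambda>J. {u :: real ^ 'p. supp u \<subseteq> J \<and> norm u = 1}"
  have pos: "(INF u\<in>?S J. ?h u) > 0" if J: "1 \<le> card J" "real (card J) \<le> r" for J
  proof -
    obtain j where "j \<in> J" using J(1) by (metis card.empty ex_in_conv not_one_le_zero)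
    moreover have "supp (axis j (1::real)) = {j}" by (auto simp: supp_def axis_def)
    ultimately have "axis j 1 \<in> ?S J" by (simp add: norm_axis_1)
    then have ne: "?S J \<noteq> {}" by blast
    have S: "?S J = sphere 0 1 \<inter> (\<Inter>i\<in>- J. {u. u $ i = 0})"
      by (auto simp: supp_def)
    have "compact (?S J)"
      unfolding S
      by (intro compact_Int_closed closed_INT ballI closed_Collect_eq continuous_intros) auto
    then obtain u where u: "u \<in> ?S J" "\<forall>v\<in>?S J. ?h u \<le> ?h v"
      using continuous_attains_inf[OF _ ne, of ?h] by (fastforce intro!: continuous_intros)
    have "X *v u \<noteq> 0"
      using full_column_rank_on_inj[of X J u] I J u(1) by (auto simp: condition_I_def)
    then have "0 < ?h u" by simp
    also have "?h u \<le> (INF u\<in>?S J. ?h u)"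
      using u(2) by (intro cINF_greatest[OF ne]) auto
    finally show ?thesis .
  qed
  let ?F = "{J :: 'p set. 1 \<le> card J \<and> real (card J) \<le> r}"
  \<comment> \<open>Any singleton is admissible because \<open>1 \<le> r\<close>.\<close>
  have "{undefined} \<in> ?F" using assms(2) by simp
  then have "?F \<noteq> {}" by blast
  then have "0 < Min ((\<lambda>J. INF u\<in>?S J. ?h u) ` ?F) \<longleftrightarrow> (\<forall>J\<in>?F. 0 < (INF u\<in>?S J. ?h u))"
    by (subst Min_gr_iff) auto
  then show ?thesis
    unfolding nu_def using pos by simp
qed

text \<open>Write \<open>w\<close> as \<open>X *v u\<close> with \<open>u\<close> supported in
  \<open>J\<close>. Then \<open>\<beta> - u\<close> is sparse enough for the restricted eigenvalue,
  and agrees with \<open>\<beta>\<close> on every missing index, each of which contributes at least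
  m^2 to its squared norm.\<close>

lemma signal_lower_bound:
  fixes X :: "real ^ 'p ^ 'n" and \<beta> :: "real ^ 'p"
  assumes I: "condition_I X r" and "1 \<le> r" "real (card (supp \<beta> \<union> J)) \<le> r"
    and w: "w \<in> col_span X J" and "0 \<le> m" and m: "\<And>j. j \<in> supp \<beta> \<Longrightarrow> m \<le> \<bar>\<beta> $ j\<bar>"
  shows "(nu X r)\<^sup>2 * real CARD('n) * m\<^sup>2 * real (card (supp \<beta> - J)) \<le> (norm (X *v \<beta> - w))\<^sup>2"
proof -
  obtain u where u: "supp u \<subseteq> J" "w = X *v u" using w by (auto simp: in_col_span_iff)
  have "supp (\<beta> - u) \<subseteq> supp \<beta> \<union> J" using u(1) by (auto simp: supp_def)
  then have "card (supp (\<beta> - u)) \<le> card (supp \<beta> \<union> J)" by (intro card_mono) auto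
  then have "real (card (supp (\<beta> - u))) \<le> r" using assms(3) by linarith
  then have le: "nu X r * sqrt (real CARD('n)) * norm (\<beta> - u) \<le> norm (X *v \<beta> - w)"
    using nu_mult_norm_le[of "\<beta> - u" r X] u(2) by (simp add: matrix_vector_mult_diff_distrib)
  have "m\<^sup>2 * real (card (supp \<beta> - J)) = (\<Sum>j\<in>supp \<beta> - J. m\<^sup>2)" by simp
  also have "\<dots> \<le> (\<Sum>j\<in>supp \<beta> - J. ((\<beta> - u) $ j)\<^sup>2)"
  proof (rule sum_mono)
    fix j assume j: "j \<in> supp \<beta> - J"
    then have "(\<beta> - u) $ j = \<beta> $ j" using u(1) by (auto simp: supp_def)
    then show "m\<^sup>2 \<le> ((\<beta> - u) $ j)\<^sup>2"
      using m[of j] j \<open>0 \<le> m\<close> by (simp add: abs_le_square_iff[symmetric])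
  qed
  also have "\<dots> \<le> (\<Sum>j\<in>UNIV. ((\<beta> - u) $ j)\<^sup>2)"
    by (intro sum_mono2) auto
  also have "\<dots> = (norm (\<beta> - u))\<^sup>2"
    unfolding power2_norm_eq_inner by (simp add: inner_vec_def power2_eq_square)
  finally have "(nu X r)\<^sup>2 * real CARD('n) * (m\<^sup>2 * real (card (supp \<beta> - J)))
      \<le> (nu X r)\<^sup>2 * real CARD('n) * (norm (\<beta> - u))\<^sup>2"
    by (intro mult_left_mono) auto
  also have "\<dots> = (nu X r * sqrt (real CARD('n)) * norm (\<beta> - u))\<^sup>2"
    by (simp add: power_mult_distrib)
  also have "\<dots> \<le> (norm (X *v \<beta> - w))\<^sup>2"
    using le nu_pos[OF I \<open>1 \<le> r\<close>] by (intro power_mono) auto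
  finally show ?thesis by (simp add: mult_ac)
qed

section \<open>Residuals after projection onto column spans\<close>

lemma linear_col_proj_perp: "linear (col_proj_perp X J)"
  unfolding col_proj_perp_def[abs_def] col_proj_def
  by (intro linear_compose_sub linear_ident linear_ortho_proj subspace_span)

lemmas col_proj_perp_add = linear_add[OF linear_col_proj_perp]

lemma borel_measurable_col_proj_perp [measurable]: "col_proj_perp X J \<in> borel_measurable borel"
  using linear_col_proj_perp
  by (intro borel_measurable_continuous_onI linear_continuous_on) (simp add: linear_conv_bounded_linear)

lemma col_proj_perp_eq_0: "w \<in> col_span X J \<Longrightarrow> col_proj_perp X J w = 0"
  by (simp add: col_proj_perp_def col_proj_def ortho_proj_self)

lemma inner_col_proj_perp: "col_proj_perp X J u \<bullet> col_proj_perp X J v = col_proj_perp X J u \<bullet> v"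
proof -
  have "col_proj_perp X J u \<in> orthogonal_comp (col_span X J)" "col_proj X J v \<in> col_span X J"
    unfolding col_proj_perp_def col_proj_def by (intro ortho_proj subspace_span)+
  then have "col_proj_perp X J u \<bullet> col_proj X J v = 0"
    by (auto simp: orthogonal_comp_def orthogonal_def inner_commute)
  then show ?thesis by (simp add: col_proj_perp_def[of X J v] inner_diff_right)
qed

text \<open>Each added column raises the dimension by at most one; linear dependence among columns
  is why only an inequality holds for \<open>card B\<close>.\<close>

lemma col_proj_perp_nested:
  fixes X :: "real ^ 'p ^ 'n"
  assumes "J \<subseteq> K"
  obtains B where "orthonormal B" "card B \<le> card (K - J)"
    "\<And>v. (norm (col_proj_perp X K v))\<^sup>2 + (\<Sum>b\<in>B. (b \<bullet> v)\<^sup>2) = (norm (col_proj_perp X J v))\<^sup>2"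
proof -
  let ?c = "\<lambda>j. column j X"
  have "col_span X J \<subseteq> col_span X K" using assms by (intro span_mono) auto
  then obtain B where B: "orthonormal B" "card B + dim (col_span X J) = dim (col_span X K)"
    "\<And>v. (norm (v - ortho_proj (col_span X K) v))\<^sup>2 + (\<Sum>b\<in>B. (b \<bullet> v)\<^sup>2) =
      (norm (v - ortho_proj (col_span X J) v))\<^sup>2"
    using residual_nested subspace_span by metis
  have "?c ` J \<union> ?c ` (K - J) = ?c ` K" using assms by auto
  then have "dim (col_span X K) \<le> dim (col_span X J) + card (K - J)"
    using dim_Un_image_le[of "K - J" "?c ` J" ?c] by simp
  then show thesis
    using B by (intro that[of B]) (auto simp: col_proj_perp_def col_proj_def)
qed

lemma norm_col_proj_perp_antimono:
  assumes "J \<subseteq> K"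
  shows "(norm (col_proj_perp X K v))\<^sup>2 \<le> (norm (col_proj_perp X J v))\<^sup>2"
proof -
  obtain B where "(norm (col_proj_perp X K v))\<^sup>2 + (\<Sum>b\<in>B. (b \<bullet> v)\<^sup>2) = (norm (col_proj_perp X J v))\<^sup>2"
    using col_proj_perp_nested[OF assms] by metis
  moreover have "(\<Sum>b\<in>B. (b \<bullet> v)\<^sup>2) \<ge> 0" by (intro sum_nonneg) auto
  ultimately show ?thesis by linarith
qed

text \<open>The mean lies in every column span containing those of its support, so only noise
  remains there; enlarging \<open>J\<close> to the union shrinks the residual. The first bound
  discards the signal and suffices for large models, the second keeps it for small ones.\<close>

lemma residual_difference_bounds:
  fixes X :: "real ^ 'p ^ 'n" and \<beta> :: "real ^ 'p" and z :: "real ^ 'n" and J :: "'p set"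
  defines "y \<equiv> X *v \<beta> + z" and "m \<equiv> col_proj_perp X J (X *v \<beta>)"
  defines "Q \<equiv> (norm (col_proj_perp X (supp \<beta>) z))\<^sup>2 - (norm (col_proj_perp X (supp \<beta> \<union> J) z))\<^sup>2"
  defines "D \<equiv> (norm (col_proj_perp X (supp \<beta>) y))\<^sup>2 - (norm (col_proj_perp X J y))\<^sup>2"
  shows "D \<le> Q" "D \<le> Q - (norm m)\<^sup>2 - 2 * (m \<bullet> z)"
proof -
  have in_span: "X *v \<beta> \<in> col_span X K" if "supp \<beta> \<subseteq> K" for K
    using that by (auto simp: in_col_span_iff)
  have eq: "col_proj_perp X K y = col_proj_perp X K z" if "supp \<beta> \<subseteq> K" for K
    unfolding y_def by (simp add: col_proj_perp_add col_proj_perp_eq_0 in_span that)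
  have mono: "(norm (col_proj_perp X (supp \<beta> \<union> J) v))\<^sup>2 \<le> (norm (col_proj_perp X J v))\<^sup>2" for v
    by (rule norm_col_proj_perp_antimono) auto
  show "D \<le> Q" using mono[of y] by (simp add: D_def Q_def eq)
  \<comment> \<open>In the cross term the noise residual may be replaced by \<open>z\<close> itself,
    because \<open>m\<close> is orthogonal to the span of \<open>J\<close>.\<close>
  have "(norm (col_proj_perp X J y))\<^sup>2 = (norm m)\<^sup>2 + 2 * (m \<bullet> z) + (norm (col_proj_perp X J z))\<^sup>2"
    unfolding y_def m_def col_proj_perp_add power2_norm_eq_inner inner_add_left inner_add_right
    using inner_col_proj_perp[of X J "X *v \<beta>" z] by (simp add: inner_commute)
  \<comment> \<open>Here the enlargement is applied to the noise alone, so that the signal term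
    survives.\<close>
  then show "D \<le> Q - (norm m)\<^sup>2 - 2 * (m \<bullet> z)"
    using mono[of z] by (simp add: D_def Q_def eq)
qed

section \<open>Posterior ratios\<close>

lemma prior_weight_nonneg: "prior_weight sbar lam J \<ge> 0"
  by (simp add: prior_weight_def)

text \<open>The size penalty is compared exactly; the binomial coefficients cost at most p^d when
  the sizes differ by at most \<open>d\<close>.\<close>

lemma prior_weight_le:
  fixes J K :: "'p::finite set"
  assumes "card K \<le> sbar" "card J \<le> sbar" "card J \<le> card K + d" "card K \<le> card J + d"
  shows "prior_weight sbar lam J \<le>
    exp (lam * (real (card K) - real (card J)) + real d * ln (real CARD('p))) * prior_weight sbar lam K"
proof -
  let ?p = "CARD('p)"
  have c: "card J \<le> ?p" "card K \<le> ?p" by (auto intro: card_mono)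
  have "(?p choose card K) \<le> ?p ^ d * (?p choose card J)"
    using c assms by (intro choose_le_power_mult_choose_dist) auto
  then have "real (?p choose card K) \<le> real ?p ^ d * real (?p choose card J)"
    by (metis of_nat_le_iff of_nat_mult of_nat_power)
  also have "real ?p ^ d = exp (real d * ln (real ?p))" by (simp add: exp_of_nat_mult)
  finally have "1 / real (?p choose card J) \<le> exp (real d * ln (real ?p)) / real (?p choose card K)"
    using c by (simp add: field_simps)
  then have "exp (- lam * real (card J)) * (1 / real (?p choose card J)) \<le>
      exp (- lam * real (card J)) * (exp (real d * ln (real ?p)) / real (?p choose card K))"
    by (intro mult_left_mono) auto
  also have "\<dots> = exp (lam * (real (card K) - real (card J)) + real d * ln (real ?p)) *
      (exp (- lam * real (card K)) / real (?p choose card K))"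
    by (simp add: mult_exp_exp algebra_simps)
  finally show ?thesis using assms by (simp add: prior_weight_def)
qed

lemma card_sym_diff:
  fixes J K :: "'p::finite set"
  shows "card (sym_diff J K) = card (J - K) + card (K - J)"
    and "card J + card (K - J) = card K + card (J - K)"
proof -
  show "card (sym_diff J K) = card (J - K) + card (K - J)" by (rule card_Un_disjoint) auto
  have "card (J \<union> (K - J)) = card (K \<union> (J - K))" by (rule arg_cong[of _ _ card]) auto
  then show "card J + card (K - J) = card K + card (J - K)"
    by (simp add: card_Un_disjoint Diff_disjoint del: Un_Diff_cancel)
qed

text \<open>Here a and t count the missing and the superfluous indices of a model, d is twice the gain
  in log-likelihood, q the squared signal lost by the model, and L = ln p. Small models pay for
  missing indices through the signal, large ones through the prior.\<close>

lemma log_ratio_bound: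
  fixes a t s j L lam c \<epsilon> d q :: real
  assumes nn: "0 \<le> a" "0 \<le> t" "0 \<le> s" "0 \<le> L" "0 < \<epsilon>" "1 \<le> c" and "a \<le> s" "t \<le> j" "j = s - a + t"
    and lam: "lam = (1 + \<epsilon>) / \<epsilon> * (23 + 5 * c) * L"
    and d1: "d \<le> 4 * (3 + c) * t * L"
    and d2: "d \<le> 4 * (3 + c) * t * L + 4 * (3 + c) * (a + t) * L - q / 2"
    and q: "j \<le> (1 + \<epsilon>) * s \<Longrightarrow> 9 * lam * a \<le> q"
  shows "lam * (s - j) + (a + t) * L + d / 2 \<le> - ((c + 8) * (a + t) * L)"
proof (cases "j \<le> (1 + \<epsilon>) * s")
  case True
  have "1 \<le> (1 + \<epsilon>) / \<epsilon>" using nn by simp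
  then have "1 * ((23 + 5 * c) * L) \<le> (1 + \<epsilon>) / \<epsilon> * ((23 + 5 * c) * L)"
    using nn by (intro mult_right_mono) auto
  then have lamL: "(23 + 5 * c) * L \<le> lam" using lam by (simp add: mult_ac)
  \<comment> \<open>With \<open>d2\<close> and \<open>q\<close>, the coefficient of \<open>a\<close>
    is at most -(5/4) lam + (7 + 2c) L and that of \<open>t\<close> is at most -lam + (13 + 4c) L.
    Both are at most -(c + 8) L by \<open>lamL\<close>.\<close>
  have "a * ((23 + 5 * c) * L) \<le> a * lam" "t * ((23 + 5 * c) * L) \<le> t * lam"
    using lamL nn by (auto intro: mult_left_mono)
  moreover have "lam * (s - j) = lam * a - lam * t"
    unfolding right_diff_distrib[symmetric] using assms(9) by simp
  moreover have "0 \<le> a * L" "0 \<le> t * L" "0 \<le> a * L * c" "0 \<le> t * L * c" using nn by auto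
  ultimately show ?thesis using d2 q[OF True] by (simp add: algebra_simps)
next
  case False
  \<comment> \<open>Since \<open>j\<close> exceeds (1 + \<epsilon>) s, the excess j - s is a fixed
    fraction of \<open>j\<close>; the factor (1 + \<epsilon>) / \<epsilon> in \<open>lam\<close>
    undoes this fraction.\<close>
  then have "\<epsilon> * j \<le> (1 + \<epsilon>) * (j - s)" by (simp add: algebra_simps)
  then have "j \<le> (1 + \<epsilon>) / \<epsilon> * (j - s)" using nn by (simp add: field_simps)
  then have "(23 + 5 * c) * L * j \<le> (23 + 5 * c) * L * ((1 + \<epsilon>) / \<epsilon> * (j - s))"
    using nn by (intro mult_left_mono) auto
  then have pen: "(23 + 5 * c) * L * j \<le> lam * (j - s)" using lam by (simp add: mult_ac)
  have "s * 1 \<le> s * (1 + \<epsilon>)" using nn by (intro mult_left_mono) auto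
  then have "a \<le> j" using False \<open>a \<le> s\<close> by (simp add: mult.commute)
  \<comment> \<open>Bounding \<open>a\<close> and \<open>t\<close> by \<open>j\<close> gives a cost
    of 24 + 4c per index, at most 23 + 5c precisely because c \<ge> 1.\<close>
  have "(9 + c) * (a + t) * L + 2 * (3 + c) * t * L \<le> (9 + c) * (j + j) * L + 2 * (3 + c) * j * L"
    using nn \<open>a \<le> j\<close> \<open>t \<le> j\<close> by (intro add_mono mult_right_mono mult_left_mono) auto
  also have "\<dots> = (24 + 4 * c) * (L * j)" by (simp add: algebra_simps)
  also have "\<dots> \<le> (23 + 5 * c) * (L * j)"
    using nn \<open>t \<le> j\<close> by (intro mult_right_mono mult_nonneg_nonneg) auto
  finally show ?thesis using pen d1 by (simp add: algebra_simps)
qed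

text \<open>The deterministic core: given the noise bounds \<open>Q\<close> and
  \<open>cross\<close>, prior and likelihood exponents combine into \<open>log_ratio_bound\<close>,
  with \<open>d\<close> the residual difference and \<open>q\<close> the squared lost signal, both
  divided by \<sigma>^2.\<close>

lemma posterior_weight_ratio:
  fixes X :: "real ^ 'p ^ 'n" and \<beta> :: "real ^ 'p" and z :: "real ^ 'n" and J :: "'p set"
    and lam \<sigma> \<epsilon> c :: real
  defines "L \<equiv> ln (real CARD('p))" and "s \<equiv> card (supp \<beta>)" and "r \<equiv> (2 + \<epsilon>) * real (card (supp \<beta>))"
    and "m \<equiv> col_proj_perp X J (X *v \<beta>)" and "k \<equiv> card (sym_diff J (supp \<beta>))"
  assumes "\<sigma> > 0" "1 \<le> s" "s \<le> sbar" "\<epsilon> > 0" "c \<ge> 1"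
    and I: "condition_I X r"
    and lam: "lam = (1 + \<epsilon>) / \<epsilon> * (23 + 5 * c) * L"
    and beta_min: "\<And>j. j \<in> supp \<beta> \<Longrightarrow> 3 * \<sigma> * sqrt (lam / real CARD('n)) / nu X r \<le> \<bar>\<beta> $ j\<bar>"
    and Q: "(norm (col_proj_perp X (supp \<beta>) z))\<^sup>2 - (norm (col_proj_perp X (supp \<beta> \<union> J) z))\<^sup>2
      \<le> 4 * (3 + c) * real (card (J - supp \<beta>)) * L * \<sigma>\<^sup>2"
    and cross: "- 2 * (m \<bullet> z) \<le> (norm m)\<^sup>2 / 2 + 4 * (3 + c) * real k * L * \<sigma>\<^sup>2"
  shows "posterior_weight X \<sigma> sbar lam (X *v \<beta> + z) J \<le>
    exp (- ((c + 8) * L)) ^ k * posterior_weight X \<sigma> sbar lam (X *v \<beta> + z) (supp \<beta>)"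
proof -
  let ?R = "\<lambda>K. (norm (col_proj_perp X K (X *v \<beta> + z)))\<^sup>2"
  define N where "N = (\<Sum>K::'p set\<in>UNIV. prior_weight sbar lam K)"
  have N: "N \<ge> 0" unfolding N_def by (intro sum_nonneg prior_weight_nonneg)
  have main: "prior_weight sbar lam J * exp (- ?R J / (2 * \<sigma>\<^sup>2)) \<le>
      exp (- ((c + 8) * L)) ^ k * (prior_weight sbar lam (supp \<beta>) * exp (- ?R (supp \<beta>) / (2 * \<sigma>\<^sup>2)))"
  proof (cases "card J \<le> sbar")
    case True
    define a t where "a = real (card (supp \<beta> - J))" and "t = real (card (J - supp \<beta>))"
    let ?D = "?R (supp \<beta>) - ?R J"
    have L: "0 \<le> L" unfolding L_def by simp
    have lam0: "0 \<le> lam" unfolding lam using L \<open>\<epsilon> > 0\<close> \<open>c \<ge> 1\<close> by simp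
    have k: "real k = a + t" unfolding k_def a_def t_def card_sym_diff by simp
    have cards: "card J + card (supp \<beta> - J) = s + card (J - supp \<beta>)"
      unfolding s_def by (rule card_sym_diff)
    then have j: "real (card J) = real s - a + t" unfolding a_def t_def by linarith
    have "s \<ge> card (supp \<beta> - J)" "card J \<ge> card (J - supp \<beta>)"
      unfolding s_def by (auto intro: card_mono)
    then have le: "a \<le> real s" "t \<le> real (card J)" by (auto simp: a_def t_def)
    have r1: "1 \<le> r"
    proof -
      have "1 * 1 \<le> (2 + \<epsilon>) * real s" using \<open>1 \<le> s\<close> \<open>\<epsilon> > 0\<close> by (intro mult_mono) auto
      then show ?thesis by (simp add: r_def s_def)
    qed
    \<comment> \<open>A model of size at most (1 + \<epsilon>) s has union with the true support of
      size at most (2 + \<epsilon>) s, the sparsity level of the rank condition. The eigenvalue in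
      \<open>?\<rho>\<close> cancels, leaving 9 \<sigma>^2 lam per missing index.\<close>
    have signal: "9 * lam * a \<le> (norm m)\<^sup>2 / \<sigma>\<^sup>2" if small: "real (card J) \<le> (1 + \<epsilon>) * real s"
    proof -
      let ?\<rho> = "3 * \<sigma> * sqrt (lam / real CARD('n)) / nu X r"
      have nu: "nu X r > 0" using nu_pos[OF I r1] .
      have "card (supp \<beta> \<union> J) \<le> s + card J" unfolding s_def by (rule card_Un_le)
      then have "real (card (supp \<beta> \<union> J)) \<le> real s + real (card J)" by linarith
      also have "\<dots> \<le> r" using small unfolding r_def s_def by (simp add: algebra_simps)
      finally have "(nu X r)\<^sup>2 * real CARD('n) * ?\<rho>\<^sup>2 * a \<le> (norm m)\<^sup>2"
        unfolding a_def m_def col_proj_perp_def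
        using \<open>\<sigma> > 0\<close> lam0 nu beta_min
        by (intro signal_lower_bound[OF I r1]) (auto simp: col_proj_def intro: ortho_proj(1))
      moreover have "(nu X r)\<^sup>2 * real CARD('n) * ?\<rho>\<^sup>2 = 9 * \<sigma>\<^sup>2 * lam"
        using nu lam0 by (simp add: power_divide power_mult_distrib)
      ultimately show ?thesis using \<open>\<sigma> > 0\<close> by (simp add: field_simps)
    qed
    have D1: "?D / \<sigma>\<^sup>2 \<le> 4 * (3 + c) * t * L"
      using residual_difference_bounds(1)[of X \<beta> z J] Q \<open>\<sigma> > 0\<close>
      by (simp add: t_def pos_divide_le_eq)
    have "?D \<le> 4 * (3 + c) * t * L * \<sigma>\<^sup>2 + 4 * (3 + c) * (a + t) * L * \<sigma>\<^sup>2 - (norm m)\<^sup>2 / 2"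
      using residual_difference_bounds(2)[of X \<beta> z J] Q cross unfolding k t_def m_def by linarith
    then have "?D / \<sigma>\<^sup>2 \<le>
        (4 * (3 + c) * t * L * \<sigma>\<^sup>2 + 4 * (3 + c) * (a + t) * L * \<sigma>\<^sup>2 - (norm m)\<^sup>2 / 2) / \<sigma>\<^sup>2"
      by (intro divide_right_mono) auto
    also have "\<dots> = 4 * (3 + c) * t * L + 4 * (3 + c) * (a + t) * L - (norm m)\<^sup>2 / \<sigma>\<^sup>2 / 2"
      using \<open>\<sigma> > 0\<close> by (simp add: field_simps)
    finally have D2: "?D / \<sigma>\<^sup>2 \<le> \<dots>" .
    have exponent: "lam * (real s - real (card J)) + (a + t) * L + ?D / \<sigma>\<^sup>2 / 2 \<le> - ((c + 8) * (a + t) * L)"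
      by (rule log_ratio_bound[OF _ _ _ L \<open>\<epsilon> > 0\<close> \<open>c \<ge> 1\<close> le j lam D1 D2 signal])
        (auto simp: a_def t_def)
    have "prior_weight sbar lam J \<le>
        exp (lam * (real s - real (card J)) + real k * L) * prior_weight sbar lam (supp \<beta>)"
      unfolding L_def s_def k_def
      using True \<open>s \<le> sbar\<close> cards by (intro prior_weight_le) (auto simp: card_sym_diff(1) s_def)
    then have "prior_weight sbar lam J * exp (- ?R J / (2 * \<sigma>\<^sup>2)) \<le>
        exp (lam * (real s - real (card J)) + real k * L) * prior_weight sbar lam (supp \<beta>) *
        exp (- ?R J / (2 * \<sigma>\<^sup>2))"
      by (rule mult_right_mono) simp
    also have "\<dots> = exp (lam * (real s - real (card J)) + (a + t) * L + ?D / \<sigma>\<^sup>2 / 2) *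
        (prior_weight sbar lam (supp \<beta>) * exp (- ?R (supp \<beta>) / (2 * \<sigma>\<^sup>2)))"
      unfolding k by (simp add: diff_divide_distrib exp_add exp_diff exp_minus field_simps)
    also have "\<dots> \<le> exp (- ((c + 8) * (a + t) * L)) *
        (prior_weight sbar lam (supp \<beta>) * exp (- ?R (supp \<beta>) / (2 * \<sigma>\<^sup>2)))"
      using exponent by (intro mult_right_mono) (auto simp: prior_weight_nonneg)
    also have "exp (- ((c + 8) * (a + t) * L)) = exp (- ((c + 8) * L)) ^ k"
      by (simp add: k mult_ac flip: exp_of_nat_mult)
    finally show ?thesis .
  next
    case False
    then have "prior_weight sbar lam J = 0" by (simp add: prior_weight_def)
    then show ?thesis by (simp add: prior_weight_nonneg)
  qed
  show ?thesis
    using divide_right_mono[OF main N]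
    by (simp add: posterior_weight_def prior_def N_def mult_ac)
qed

section \<open>From weight ratios to posterior probabilities\<close>

lemma prior_weight_pos:
  fixes J :: "'p::finite set"
  assumes "card J \<le> sbar"
  shows "prior_weight sbar lam J > 0"
proof -
  have "card J \<le> CARD('p)" by (rule card_mono) auto
  then show ?thesis using assms by (simp add: prior_weight_def)
qed

lemma posterior_weight_pos:
  fixes X :: "real ^ 'p ^ 'n" and J :: "'p set"
  assumes "card J \<le> sbar"
  shows "posterior_weight X \<sigma> sbar lam y J > 0"
proof -
  have "(\<Sum>K\<in>(UNIV :: 'p set set). prior_weight sbar lam K) > 0"
    using prior_weight_pos[OF assms, of lam] prior_weight_nonneg
    by (intro sum_pos2[of _ J]) auto
  then show ?thesis using prior_weight_pos[OF assms] by (simp add: posterior_weight_def prior_def)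
qed

lemma posterior_weight_nonneg: "posterior_weight X \<sigma> sbar lam y J \<ge> 0"
  by (simp add: posterior_weight_def prior_def prior_weight_nonneg sum_nonneg)

text \<open>A wrong model has a nonempty symmetric difference with \<open>J0\<close>, so its ratio
  is below one; summed over all such differences, the competing mass is at most 2 p x times the
  weight of \<open>J0\<close>.\<close>

lemma posterior_concentration:
  fixes X :: "real ^ 'p ^ 'n" and J0 :: "'p set"
  assumes "card J0 \<le> sbar" and "0 \<le> x" "x < 1" "real CARD('p) * x \<le> 1 / 2"
    and ratio: "\<And>J. J \<noteq> J0 \<Longrightarrow> posterior_weight X \<sigma> sbar lam y J \<le>
      x ^ card (sym_diff J J0) * posterior_weight X \<sigma> sbar lam y J0"
  shows "J \<noteq> J0 \<Longrightarrow> posterior X \<sigma> sbar lam y J < posterior X \<sigma> sbar lam y J0"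
    and "1 - 2 * (real CARD('p) * x) \<le> posterior X \<sigma> sbar lam y J0"
proof -
  let ?w = "posterior_weight X \<sigma> sbar lam y"
  let ?W = "\<Sum>K\<in>UNIV. ?w K"
  have w0: "?w J0 > 0" using assms(1) by (rule posterior_weight_pos)
  have W: "?W > 0" using w0 posterior_weight_nonneg by (intro sum_pos2[of _ J0]) auto
  show "posterior X \<sigma> sbar lam y J < posterior X \<sigma> sbar lam y J0" if "J \<noteq> J0"
  proof -
    have "sym_diff J J0 \<noteq> {}" using that by auto
    then have "card (sym_diff J J0) \<noteq> 0" by simp
    then have "x ^ card (sym_diff J J0) < 1"
      using assms(2,3) by (intro power_Suc_less_one power_less_one_iff[THEN iffD2]) auto
    then have "?w J < ?w J0"
      using ratio[OF that] w0 by (smt (verit) mult_less_cancel_right2)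
    then show ?thesis using W by (simp add: posterior_def divide_strict_right_mono)
  qed
  have "(\<Sum>J\<in>- {J0}. ?w J) \<le> (\<Sum>J\<in>- {J0}. x ^ card (sym_diff J J0) * ?w J0)"
    by (intro sum_mono ratio) auto
  also have "\<dots> = (\<Sum>K\<in>- {{} :: 'p set}. x ^ card K) * ?w J0"
    unfolding sum_distrib_right[symmetric] by (subst sum_sym_diff_reindex) (rule refl)
  also have "\<dots> \<le> 2 * (real CARD('p) * x) * ?w J0"
    using sum_nonempty_subsets_power_le[of x, where 'p = 'p] assms(2,4) w0
    by (intro mult_right_mono) auto
  finally have rest: "(\<Sum>J\<in>- {J0}. ?w J) \<le> 2 * (real CARD('p) * x) * ?w J0" .
  have split: "?W = ?w J0 + (\<Sum>J\<in>- {J0}. ?w J)"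
    by (subst sum.remove[of UNIV J0]) (auto simp: Compl_eq_Diff_UNIV)
  have "(\<Sum>J\<in>- {J0}. ?w J) \<ge> 0" by (intro sum_nonneg posterior_weight_nonneg)
  then have "?w J0 \<le> ?W" unfolding split by simp
  then have "2 * (real CARD('p) * x) * ?w J0 \<le> 2 * (real CARD('p) * x) * ?W"
    using assms(2) by (intro mult_left_mono) auto
  \<comment> \<open>Bounding \<open>?w J0\<close> by the total in the remainder gives a linear bound
    in place of 1/(1 + 2 p x).\<close>
  then have "(1 - 2 * (real CARD('p) * x)) * ?W \<le> ?w J0"
    using rest split by (simp add: algebra_simps)
  then show "1 - 2 * (real CARD('p) * x) \<le> posterior X \<sigma> sbar lam y J0"
    using W by (simp add: posterior_def pos_le_divide_eq)
qed

section \<open>Noise control and conclusion\<close>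

text \<open>The decrease is a sum of at most \<open>card (K - J)\<close> squared Gaussian
  coordinates. Dividing by 4 \<sigma>^2 and applying Chernoff costs \<open>sqrt 2\<close> per
  coordinate and gains \<open>exp (- h)\<close> per index.\<close>

lemma residual_decrease_tail:
  fixes X :: "real ^ 'p ^ 'n" and z :: "'a \<Rightarrow> real ^ 'n"
  assumes M: "prob_space M" and "\<sigma> > 0" and iso: "isotropic_gaussian M \<sigma> z" and "0 \<le> h"
  shows "measure M {\<omega> \<in> space M. 4 * h * real (card (K - J)) * \<sigma>\<^sup>2 <
      (norm (col_proj_perp X J (z \<omega>)))\<^sup>2 - (norm (col_proj_perp X (J \<union> K) (z \<omega>)))\<^sup>2}
    \<le> (sqrt 2 * exp (- h)) ^ card (K - J)"
proof -
  interpret prob_space M by fact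
  have [measurable]: "z \<in> borel_measurable M" using iso by (rule isotropic_gaussian_measurable)
  let ?t = "card (K - J)"
  have "J \<union> K - J = K - J" by blast
  then obtain B where B: "orthonormal B" "card B \<le> ?t"
    "\<And>v. (norm (col_proj_perp X (J \<union> K) v))\<^sup>2 + (\<Sum>b\<in>B. (b \<bullet> v)\<^sup>2) = (norm (col_proj_perp X J v))\<^sup>2"
    using col_proj_perp_nested[of J "J \<union> K" X] by (metis Un_upper1)
  let ?f = "\<lambda>\<omega>. (\<Sum>b\<in>B. (b \<bullet> z \<omega>)\<^sup>2) / (4 * \<sigma>\<^sup>2)"
  have eq: "(norm (col_proj_perp X J v))\<^sup>2 - (norm (col_proj_perp X (J \<union> K) v))\<^sup>2 = (\<Sum>b\<in>B. (b \<bullet> v)\<^sup>2)"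
    for v using B(3)[of v] by simp
  have "prob {\<omega> \<in> space M. 4 * h * real ?t * \<sigma>\<^sup>2 <
      (norm (col_proj_perp X J (z \<omega>)))\<^sup>2 - (norm (col_proj_perp X (J \<union> K) (z \<omega>)))\<^sup>2}
    \<le> prob {\<omega> \<in> space M. h * real ?t \<le> ?f \<omega>}"
    unfolding eq using \<open>\<sigma> > 0\<close> by (intro finite_measure_mono) (auto simp: field_simps)
  also have "\<dots> \<le> sqrt 2 ^ card B * exp (- (h * real ?t))"
    using nn_integral_gaussian_exp_chi_square[OF M \<open>\<sigma> > 0\<close> iso B(1), of 0]
    by (intro prob_ge_le_exp_moment) auto
  also have "\<dots> \<le> sqrt 2 ^ ?t * exp (- (h * real ?t))"
    using B(2) by (intro mult_right_mono power_increasing) auto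
  also have "\<dots> = (sqrt 2 * exp (- h)) ^ ?t"
    by (simp add: power_mult_distrib mult.commute flip: exp_of_nat_mult)
  finally show ?thesis .
qed

lemma cross_term_tail:
  fixes m :: "real ^ 'n" and z :: "'a \<Rightarrow> real ^ 'n"
  assumes M: "prob_space M" and "\<sigma> > 0" and iso: "isotropic_gaussian M \<sigma> z"
  shows "measure M {\<omega> \<in> space M. (norm m)\<^sup>2 / 2 + 4 * h * \<sigma>\<^sup>2 < - 2 * (m \<bullet> z \<omega>)} \<le> exp (- h)"
proof -
  interpret prob_space M by fact
  have [measurable]: "z \<in> borel_measurable M" using iso by (rule isotropic_gaussian_measurable)
  \<comment> \<open>This tilt divides the event's inequality by 4 \<sigma>^2: the threshold becomes
    \<open>?q + h\<close> and the log-moment is exactly \<open>?q\<close>, so the bound no longer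
    depends on \<open>m\<close>. Only half of the squared signal is spent.\<close>
  let ?v = "(- 1 / (2 * \<sigma>\<^sup>2)) *\<^sub>R m"
  let ?q = "(norm m)\<^sup>2 / (8 * \<sigma>\<^sup>2)"
  have q: "\<sigma>\<^sup>2 * (norm ?v)\<^sup>2 / 2 = ?q"
    using \<open>\<sigma> > 0\<close> by (simp add: power_mult_distrib power_divide power2_eq_square)
  have "prob {\<omega> \<in> space M. (norm m)\<^sup>2 / 2 + 4 * h * \<sigma>\<^sup>2 < - 2 * (m \<bullet> z \<omega>)}
    \<le> prob {\<omega> \<in> space M. ?q + h \<le> ?v \<bullet> z \<omega>}"
  proof (intro finite_measure_mono subsetI)
    fix \<omega> assume \<omega>: "\<omega> \<in> {\<omega> \<in> space M. (norm m)\<^sup>2 / 2 + 4 * h * \<sigma>\<^sup>2 < - 2 * (m \<bullet> z \<omega>)}"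
    have "?q + h = ((norm m)\<^sup>2 / 2 + 4 * h * \<sigma>\<^sup>2) / (4 * \<sigma>\<^sup>2)"
      using \<open>\<sigma> > 0\<close> by (simp add: field_simps)
    also have "\<dots> \<le> - 2 * (m \<bullet> z \<omega>) / (4 * \<sigma>\<^sup>2)"
      using \<omega> by (intro divide_right_mono) auto
    also have "\<dots> = ?v \<bullet> z \<omega>" by simp
    finally show "\<omega> \<in> {\<omega> \<in> space M. ?q + h \<le> ?v \<bullet> z \<omega>}" using \<omega> by simp
  qed measurable
  also have "\<dots> \<le> exp ?q * exp (- (?q + h))"
    using nn_integral_gaussian_exp_linear[OF M \<open>\<sigma> > 0\<close> iso, of ?v] unfolding q
    by (intro prob_ge_le_exp_moment) auto
  also have "\<dots> = exp (- h)" by (simp add: mult_exp_exp)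
  finally show ?thesis .
qed

section \<open>Union bounds over supports and assembly\<close>

theorem theorem2:
  fixes M :: "'a measure"
    and X :: "real ^ 'p ^ 'n"
    and z y :: "'a \<Rightarrow> real ^ 'n"
    and \<beta> :: "real ^ 'p"
    and Js :: "'p set"
    and s sbar :: nat
    and \<sigma> \<epsilon> c lam \<rho> :: real
  assumes "prob_space M"
    and "CARD('p) \<ge> CARD('n)"
    and "\<And>j. norm (column j X) = sqrt (real CARD('n))"
    and "\<sigma> > 0"
    and "isotropic_gaussian M \<sigma> z"
    and "\<And>\<omega>. y \<omega> = X *v \<beta> + z \<omega>"
    and "sparsest_representation X (integral\<^sup>L M y) \<beta>"
    and "Js = supp \<beta>"
    and "s = card Js"
    and "1 \<le> s" and "s \<le> sbar" and "sbar \<le> CARD('p)"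
    and "\<epsilon> > 0" and "c \<ge> 1"
    and "condition_I X ((2 + \<epsilon>) * real s)"
    and "lam = (1 + \<epsilon>) / \<epsilon> * (23 + 5 * c) * ln (real CARD('p))"
    and "\<rho> = 3 * \<sigma> * sqrt (lam / real CARD('n)) / nu X ((2 + \<epsilon>) * real s)"
    and "(MIN j\<in>Js. \<bar>\<beta> $ j\<bar>) \<ge> \<rho>"
  shows "measure M {\<omega> \<in> space M.
             (\<forall>J. J \<noteq> Js \<longrightarrow> posterior X \<sigma> sbar lam (y \<omega>) Js > posterior X \<sigma> sbar lam (y \<omega>) J) \<and>
             posterior X \<sigma> sbar lam (y \<omega>) Js \<ge> 1 - 4 * real CARD('p) powr (- c)}
         \<ge> 1 - 2 * real CARD('p) powr (- c)"
proof (cases "CARD('p) = 1")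
  \<comment> \<open>With one column the claimed lower bound is 1 - 2 < 0; the numerical estimates in
    the other case use p \<ge> 2.\<close>
  case True
  show ?thesis unfolding True by (rule order_trans[OF _ measure_nonneg]) simp
next
  case False
  interpret prob_space M by fact
  note iso = \<open>isotropic_gaussian M \<sigma> z\<close>
  have z [measurable]: "z \<in> borel_measurable M" using iso by (rule isotropic_gaussian_measurable)
  let ?p = "real CARD('p)"
  define L where "L = ln ?p"
  define pc where "pc = ?p powr (- c)"
  have p2: "2 \<le> ?p"
  proof -
    have "CARD('p) \<noteq> 0" by simp
    then have "2 \<le> CARD('p)" using False by linarith
    then show ?thesis by linarith
  qed
  have pc: "0 < pc" unfolding pc_def using p2 by simp
  have "pc \<le> ?p powr (-1)"
    unfolding pc_def using p2 \<open>c \<ge> 1\<close> by (intro powr_mono) auto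
  also have "\<dots> = 1 / ?p" using p2 by (simp add: powr_minus_divide)
  also have "\<dots> \<le> 1 / 2" using p2 by (intro divide_left_mono) auto
  finally have pc_half: "pc \<le> 1 / 2" .
  have expL: "exp (- ((c + real n) * L)) = pc / ?p ^ n" for n
    using p2 by (simp add: pc_def L_def powr_def algebra_simps exp_diff exp_add exp_of_nat_mult exp_minus field_simps)
  \<comment> \<open>Factors per index: \<open>x1\<close> for the chi-square tail, \<open>x2\<close>
    for the cross-term tail, \<open>x\<close> for the posterior ratio. Multiplying by p leaves
    p^(-2) \<le> 1/4 of the p^(-3), enough to absorb \<open>sqrt 2\<close> and keep each product
    below \<open>pc / 2\<close>; each sum over nonempty sets is then at most
    \<open>pc\<close>.\<close>
  define x1 where "x1 = sqrt 2 * exp (- ((3 + c) * L))"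
  define x2 where "x2 = exp (- ((3 + c) * L))"
  define x where "x = exp (- ((c + 8) * L))"
  have x: "x2 = pc / ?p ^ 3" "x1 = sqrt 2 * (pc / ?p ^ 3)"
    using expL[of 3] by (simp_all add: x2_def x1_def add.commute)
  have pw: "4 \<le> ?p ^ 2" using power_mono[OF p2, of 2] by simp
  have bound: "?p * (pc / ?p ^ 3) \<le> pc / 4"
  proof -
    have "?p * (pc / ?p ^ 3) = pc / ?p ^ 2" using p2 by (simp add: eval_nat_numeral)
    also have "\<dots> \<le> pc / 4" using pw pc by (intro divide_left_mono) auto
    finally show ?thesis .
  qed
  have "sqrt 2 \<le> (2::real)" by (rule real_le_lsqrt) auto
  then have "?p * x1 \<le> 2 * (pc / 4)"
    using mult_mono[OF _ bound, of "sqrt 2" 2] pc by (simp add: x(2) mult_ac)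
  then have x1: "0 \<le> x1" "?p * x1 \<le> pc / 2" by (auto simp: x1_def)
  have "?p * x2 \<le> pc / 2" unfolding x(1) using bound pc by linarith
  then have x2: "0 \<le> x2" "?p * x2 \<le> pc / 2" by (auto simp: x2_def)
  have "x \<le> x2" unfolding x_def x2_def L_def using p2 by (auto intro: mult_right_mono)
  then have "?p * x \<le> ?p * x2" by (intro mult_left_mono) auto
  then have "?p * x \<le> pc / 2" using x2 by linarith
  then have x0: "0 \<le> x" "?p * x \<le> pc / 2" by (simp_all add: x_def)
  have "x < 1" unfolding x_def L_def using p2 \<open>c \<ge> 1\<close> by simp

  let ?Q = "\<lambda>T \<omega>. (norm (col_proj_perp X Js (z \<omega>)))\<^sup>2 - (norm (col_proj_perp X (Js \<union> T) (z \<omega>)))\<^sup>2"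
  let ?m = "\<lambda>J. col_proj_perp X J (X *v \<beta>)"
  let ?k = "\<lambda>J. card (sym_diff J Js)"
  define E1 where "E1 T = {\<omega> \<in> space M. 4 * ((3 + c) * L) * real (card (T - Js)) * \<sigma>\<^sup>2 < ?Q T \<omega>}" for T
  define E2 where "E2 J = {\<omega> \<in> space M.
      (norm (?m J))\<^sup>2 / 2 + 4 * ((3 + c) * L * real (?k J)) * \<sigma>\<^sup>2 < - 2 * (?m J \<bullet> z \<omega>)}" for J
  define G where "G = {\<omega> \<in> space M.
      (\<forall>J. J \<noteq> Js \<longrightarrow> posterior X \<sigma> sbar lam (y \<omega>) Js > posterior X \<sigma> sbar lam (y \<omega>) J) \<and>
      posterior X \<sigma> sbar lam (y \<omega>) Js \<ge> 1 - 4 * pc}"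
  let ?A1 = "\<Union>T\<in>{T :: 'p set. T \<inter> Js = {} \<and> T \<noteq> {}}. E1 T" and ?A2 = "\<Union>J\<in>- {Js}. E2 J"
  have hL: "0 \<le> (3 + c) * L" unfolding L_def using p2 \<open>c \<ge> 1\<close> by simp
  have E_sets [measurable]: "E1 T \<in> events" "E2 T \<in> events" for T
    unfolding E1_def E2_def by measurable
  have "prob ?A1 \<le> (\<Sum>T\<in>{T :: 'p set. T \<inter> Js = {} \<and> T \<noteq> {}}. prob (E1 T))"
    by (intro finite_measure_subadditive_finite) auto
  also have "\<dots> \<le> (\<Sum>T\<in>{T :: 'p set. T \<inter> Js = {} \<and> T \<noteq> {}}. x1 ^ card T)"
  proof (rule sum_mono)
    fix T assume "T \<in> {T :: 'p set. T \<inter> Js = {} \<and> T \<noteq> {}}"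
    then have "T - Js = T" by blast
    then show "prob (E1 T) \<le> x1 ^ card T"
      using residual_decrease_tail[OF \<open>prob_space M\<close> \<open>\<sigma> > 0\<close> iso hL, where K = T and J = Js and X = X]
      by (simp add: E1_def x1_def)
  qed
  also have "\<dots> \<le> (\<Sum>T\<in>- {{} :: 'p set}. x1 ^ card T)"
    using x1(1) by (intro sum_mono2) auto
  also have "\<dots> \<le> pc"
    using sum_nonempty_subsets_power_le[of x1, where 'p = 'p] x1 pc_half by simp
  finally have A1: "prob ?A1 \<le> pc" .
  have "prob ?A2 \<le> (\<Sum>J\<in>- {Js}. prob (E2 J))"
    by (intro finite_measure_subadditive_finite) auto
  also have "\<dots> \<le> (\<Sum>J\<in>- {Js}. x2 ^ ?k J)"
  proof (rule sum_mono)
    fix J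
    have "prob (E2 J) \<le> exp (- ((3 + c) * L * real (?k J)))"
      unfolding E2_def by (rule cross_term_tail[OF \<open>prob_space M\<close> \<open>\<sigma> > 0\<close> iso])
    also have "\<dots> = x2 ^ ?k J" by (simp add: x2_def mult.commute flip: exp_of_nat_mult)
    finally show "prob (E2 J) \<le> x2 ^ ?k J" .
  qed
  also have "\<dots> = (\<Sum>K\<in>- {{} :: 'p set}. x2 ^ card K)" by (rule sum_sym_diff_reindex)
  also have "\<dots> \<le> pc"
    using sum_nonempty_subsets_power_le[of x2, where 'p = 'p] x2 pc_half by simp
  finally have A2: "prob ?A2 \<le> pc" .

  have good: "space M - (?A1 \<union> ?A2) \<subseteq> G"
  proof
    fix \<omega> assume \<omega>: "\<omega> \<in> space M - (?A1 \<union> ?A2)"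
    have space: "\<omega> \<in> space M" using \<omega> by (rule DiffD1)
    have nE: "\<omega> \<notin> E1 T" if "T \<in> {T. T \<inter> Js = {} \<and> T \<noteq> {}}" for T
      using \<omega> that by (simp only: Diff_iff Un_iff UN_iff) (metis (no_types))
    have Q: "?Q J \<omega> \<le> 4 * (3 + c) * real (card (J - Js)) * L * \<sigma>\<^sup>2" for J
    proof (cases "J - Js = {}")
      case True
      then have "Js \<union> J = Js" by blast
      moreover have "card (J - Js) = 0" unfolding True by simp
      ultimately show ?thesis by (simp only:)
    next
      case False
      then have "J - Js \<in> {T. T \<inter> Js = {} \<and> T \<noteq> {}}" by auto
      then have "\<omega> \<notin> E1 (J - Js)" by (rule nE)
      then have "?Q (J - Js) \<omega> \<le> 4 * ((3 + c) * L) * real (card (J - Js - Js)) * \<sigma>\<^sup>2"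
        using space by (simp add: E1_def not_less)
      then show ?thesis by (simp only: mult_ac Un_Diff_cancel Diff_idemp)
    qed
    have cross: "- 2 * (?m J \<bullet> z \<omega>) \<le> (norm (?m J))\<^sup>2 / 2 + 4 * (3 + c) * real (?k J) * L * \<sigma>\<^sup>2"
      if "J \<noteq> Js" for J
    proof -
      have "J \<in> - {Js}" using that by simp
      then have "\<omega> \<notin> E2 J" using \<omega> by (simp only: Diff_iff Un_iff UN_iff) (metis (no_types))
      then have "- 2 * (?m J \<bullet> z \<omega>) \<le> (norm (?m J))\<^sup>2 / 2 + 4 * ((3 + c) * L * real (?k J)) * \<sigma>\<^sup>2"
        using space by (simp add: E2_def not_less)
      then show ?thesis by (simp only: mult_ac)
    qed
    have beta_min: "\<rho> \<le> \<bar>\<beta> $ j\<bar>" if "j \<in> supp \<beta>" for j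
    proof -
      have "(MIN j\<in>Js. \<bar>\<beta> $ j\<bar>) \<le> \<bar>\<beta> $ j\<bar>"
        using that \<open>Js = supp \<beta>\<close> by (intro Min_le) auto
      then show ?thesis using \<open>(MIN j\<in>Js. \<bar>\<beta> $ j\<bar>) \<ge> \<rho>\<close> by linarith
    qed
    have ratio: "posterior_weight X \<sigma> sbar lam (y \<omega>) J \<le>
        x ^ ?k J * posterior_weight X \<sigma> sbar lam (y \<omega>) Js" if "J \<noteq> Js" for J
      using posterior_weight_ratio[OF \<open>\<sigma> > 0\<close>, of \<beta> sbar \<epsilon> c X lam "z \<omega>" J]
        assms(10-16) beta_min[unfolded assms(17)] Q[of J] cross[OF that]
      unfolding x_def L_def assms(6) \<open>s = card Js\<close> \<open>Js = supp \<beta>\<close> by blast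
    have card: "card Js \<le> sbar" using assms(9,11) by simp
    have "?p * x \<le> 1 / 2" using x0 pc_half by linarith
    note conc = posterior_concentration[OF card x0(1) \<open>x < 1\<close> this ratio]
    \<comment> \<open>The summation gives at least 1 - pc, stronger than the required 1 - 4
      pc.\<close>
    have "1 - 4 * pc \<le> 1 - 2 * (?p * x)" using x0(2) pc by linarith
    also have "\<dots> \<le> posterior X \<sigma> sbar lam (y \<omega>) Js" by (rule conc(2))
    finally show "\<omega> \<in> G" using conc(1) \<omega> by (auto simp: G_def)
  qed
  have G: "G \<in> events"
    unfolding G_def posterior_def posterior_weight_def assms(6) by measurable
  have "prob (?A1 \<union> ?A2) \<le> prob ?A1 + prob ?A2"
    by (intro measure_Un_le) auto
  then have "1 - 2 * pc \<le> 1 - prob (?A1 \<union> ?A2)" using A1 A2 by linarith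
  also have "\<dots> = prob (space M - (?A1 \<union> ?A2))" by (intro prob_compl[symmetric]) auto
  also have "\<dots> \<le> prob G" using good G by (rule finite_measure_mono)
  finally show ?thesis by (simp add: G_def pc_def)
qed

end
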